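(* Let $g:[0,1]\to\mathbb{R}$ be continuous with $g(0)=0$. Suppose $f$ is nonnegative and integrable on a simply connected planar domain $\Omega\subset\mathbb{C}$ with $\int_\Omega f(z)\,|dz|^2>0$. If $F:\Omega\to\mathbb{D}$ is continuous and $g(1)>0$, then a point $w\in\mathbb{D}$ exists such that $\nu\circ T_w\circ F$ is orthogonal to $f$, meaning $$\int_\Omega\nu\big(T_w(F(z))\big)\,f(z)\,|dz|^2=0.$$ If in addition $g$ is strictly increasing, or else $F$ is a $C^1$-diffeomorphism and $g$ is increasing with $g(r)>0$ for all $0<r<1$, then the point $w$ is unique.
   Context: $\mathbb{D}$ is the open unit disk in the complex plane $\mathbb{C}$ and $\overline{\mathbb{D}}$ its closure. For $w\in\mathbb{D}$, $T_w(z)=\dfrac{z+w}{1+z\overline{w}}$ for $z\in\overline{\mathbb{D}}$. The function $\nu:\overline{\mathbb{D}}\to\mathbb{C}$ is $\nu(re^{i\theta})=g(r)e^{i\theta}$ (so $\nu(0)=0$). $|dz|^2$ denotes area (Lebesgue) measure on the plane. "Increasing" means non-strictly increasing (nondecreasing). *)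

theory Defs
  imports "HOL-Analysis.Analysis"
begin

definition disk_aut :: "complex \<Rightarrow> complex \<Rightarrow> complex" where
  "disk_aut w z = (z + w) / (1 + z * cnj w)"

definition nu :: "(real \<Rightarrow> real) \<Rightarrow> complex \<Rightarrow> complex" where
  "nu g z = of_real (g (cmod z)) * cis (Arg z)"

lemma nu_0: "g 0 = 0 \<Longrightarrow> nu g 0 = 0"
  by (simp add: nu_def)

lemma nu_polar:
  assumes "g 0 = 0" and "0 \<le> r"
  shows "nu g (of_real r * cis \<theta>) = of_real (g r) * cis \<theta>"
proof (cases "r = 0")
  case True
  with assms show ?thesis by (simp add: nu_def)
next
  case False
  with assms have "r > 0" by simp
  then have "cis (Arg (of_real r * cis \<theta>)) = cis \<theta>"
    by (subst cis_Arg) (auto simp: sgn_mult sgn_of_real)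
  with \<open>r > 0\<close> show ?thesis by (simp add: nu_def norm_mult)
qed

(* Frechet differentiability over the reals: for maps of the complex plane this is C^1
   in the sense of real variables, with no holomorphy implied. *)
definition C1_on :: "('a::real_normed_vector \<Rightarrow> 'b::real_normed_vector) \<Rightarrow> 'a set \<Rightarrow> bool" where
  "C1_on f S \<longleftrightarrow>
     (\<exists>f' :: 'a \<Rightarrow> 'a \<Rightarrow>\<^sub>L 'b.
        (\<forall>x\<in>S. (f has_derivative blinfun_apply (f' x)) (at x)) \<and> continuous_on S f')"

(* S and T are meant to be open. The map is onto T. *)
definition C1_diffeomorphism ::
  "('a::real_normed_vector \<Rightarrow> 'b::real_normed_vector) \<Rightarrow> 'a set \<Rightarrow> 'b set \<Rightarrow> bool" where
  "C1_diffeomorphism F S T \<longleftrightarrow>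
     bij_betw F S T \<and> C1_on F S \<and> C1_on (inv_into S F) T"

end

(* The map V w = \<integral> nu (T_w F) f extends continuously to the closed disk, because T_w is the
   constant w on the unit circle, and there V w = g(1) (\<integral> f) w. Were V to vanish nowhere, Brouwer's
   theorem for - V / |V| would give a contradiction.

   For uniqueness, two zeros w1, w2 are related by T_{w2} = e T_b T_{w1} with |e| = 1, so the zeros
   may be taken to be 0 and a > 0 after a rotation. The hyperbolic translation T_a strictly increases
   the real part of nu: everywhere if g is strictly increasing, and off the real axis if g is
   only increasing and positive. The exceptional set is null when F is a diffeomorphism. *)

theory Submission imports Defs begin

section \<open>Rotation equivariance and continuity of \<open>nu\<close>\<close>

lemma nu_eq_sgn:
  assumes "g 0 = 0"
  shows "nu g z = of_real (g (cmod z)) * sgn z"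
  using assms by (cases "z = 0") (auto simp: nu_def cis_Arg)

lemma nu_mult_unit:
  assumes "g 0 = 0" "cmod e = 1"
  shows "nu g (e * z) = e * nu g z"
  using assms by (simp add: nu_eq_sgn norm_mult sgn_mult sgn_div_norm scaleR_conv_of_real)

text \<open>Away from the origin this is a product of continuous functions. At the origin
  \<open>sgn\<close> jumps, but the other factor \<open>g (cmod z)\<close> tends to
  \<open>g 0 = 0\<close> while the angular factor stays bounded.\<close>

lemma continuous_on_nu:
  assumes g: "continuous_on {0..1} g" and g0: "g 0 = 0"
  shows "continuous_on (cball 0 1) (nu g)"
proof -
  have gn: "continuous_on (cball 0 1) (\<lambda>z::complex. g (cmod z))"
    by (rule continuous_on_compose2[OF g]) (auto intro: continuous_intros)
  have eq: "nu g = (\<lambda>z. of_real (g (cmod z)) * sgn z)"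
    using g0 by (intro ext) (rule nu_eq_sgn)
  have "continuous (at x within cball 0 1) (nu g)" if x: "x \<in> cball 0 1" for x
  proof -
    have c: "((\<lambda>z. g (cmod z)) \<longlongrightarrow> g (cmod x)) (at x within cball 0 1)"
      using gn x by (simp add: continuous_on_def)
    show ?thesis
    proof (cases "x = 0")
      case True
      have "((\<lambda>z. \<bar>g (cmod z)\<bar>) \<longlongrightarrow> 0) (at x within cball 0 1)"
        using tendsto_rabs[OF c] True g0 by simp
      then have "(nu g \<longlongrightarrow> 0) (at x within cball 0 1)"
        by (rule Lim_null_comparison[rotated]) (simp add: nu_def norm_mult)
      then show ?thesis
        using True g0 by (simp add: continuous_within nu_def)
    next
      case False
      then show ?thesis
        unfolding eq continuous_within by (intro tendsto_intros c)
    qed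
  qed
  then show ?thesis
    by (simp add: continuous_on_eq_continuous_within)
qed

section \<open>Algebra of the disk automorphisms, with parameters in the closed disk where
  possible\<close>

lemma disk_aut_denom_nonzero:
  assumes "cmod z < 1" "cmod w \<le> 1"
  shows "1 + z * cnj w \<noteq> 0"
proof
  assume "1 + z * cnj w = 0"
  then have "cmod (z * cnj w) = 1"
    by (metis add_eq_0_iff norm_minus_cancel norm_one)
  moreover have "cmod z * cmod w \<le> cmod z * 1"
    using assms by (intro mult_left_mono) auto
  ultimately show False
    using assms by (simp add: norm_mult)
qed

text \<open>The cross terms \<open>2 * Re (z * cnj w)\<close> of the two squares cancel. The sign of
  the right side then decides whether the quotient \<open>disk_aut w z\<close> stays in the open or
  the closed disk.\<close>

lemma disk_aut_norm_identity:
  "(cmod (1 + z * cnj w))\<^sup>2 - (cmod (z + w))\<^sup>2 = (1 - (cmod z)\<^sup>2) * (1 - (cmod w)\<^sup>2)"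
  unfolding cmod_power2 by (simp add: power2_eq_square algebra_simps)

lemma norm_disk_aut_le_1:
  assumes "cmod z < 1" "cmod w \<le> 1"
  shows "cmod (disk_aut w z) \<le> 1"
proof -
  have "0 \<le> (1 - (cmod z)\<^sup>2) * (1 - (cmod w)\<^sup>2)"
    using assms by (intro mult_nonneg_nonneg) (auto simp: power_le_one)
  then have "(cmod (z + w))\<^sup>2 \<le> (cmod (1 + z * cnj w))\<^sup>2"
    using disk_aut_norm_identity[of z w] by linarith
  then have "cmod (z + w) \<le> cmod (1 + z * cnj w)"
    by (rule power2_le_imp_le) simp
  then show ?thesis
    by (simp add: disk_aut_def norm_divide divide_le_eq_1)
qed

lemma norm_disk_aut_less_1:
  assumes "cmod z < 1" "cmod w < 1"
  shows "cmod (disk_aut w z) < 1"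
proof -
  have "0 < (1 - (cmod z)\<^sup>2) * (1 - (cmod w)\<^sup>2)"
    using assms by (intro mult_pos_pos) (auto simp: power_less_one_iff)
  then have "(cmod (z + w))\<^sup>2 < (cmod (1 + z * cnj w))\<^sup>2"
    using disk_aut_norm_identity[of z w] by linarith
  then have "cmod (z + w) < cmod (1 + z * cnj w)"
    by (rule power2_less_imp_less) simp
  then show ?thesis
    by (simp add: disk_aut_def norm_divide divide_less_eq_1)
qed

lemma disk_aut_boundary:
  assumes "cmod z < 1" "cmod w = 1"
  shows "disk_aut w z = w"
proof -
  have "w * cnj w = 1"
    using assms by (simp add: complex_norm_square[symmetric])
  then have "z + w = w * (1 + z * cnj w)"
    by (simp add: algebra_simps)
  then show ?thesis
    using disk_aut_denom_nonzero[of z w] assms by (simp add: disk_aut_def)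
qed

lemma disk_aut_minus_cancel:
  assumes "cmod z < 1" "cmod w < 1"
  shows "disk_aut (- w) (disk_aut w z) = z"
proof -
  define d where "d = 1 + z * cnj w"
  have d: "d \<noteq> 0"
    unfolding d_def using assms by (intro disk_aut_denom_nonzero) auto
  have e: "1 - w * cnj w \<noteq> 0"
    using disk_aut_denom_nonzero[of "-w" w] assms by simp
  have "disk_aut (- w) (disk_aut w z) = ((z + w) / d - w) / (1 - (z + w) / d * cnj w)"
    by (simp add: disk_aut_def d_def)
  also have "\<dots> = ((z + w - w * d) / d) / ((d - (z + w) * cnj w) / d)"
    using d by (simp add: field_simps)
  also have "\<dots> = (z + w - w * d) / (d - (z + w) * cnj w)"
    using d by simp
  also have "z + w - w * d = z * (1 - w * cnj w)"
    by (simp add: d_def algebra_simps)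
  also have "d - (z + w) * cnj w = 1 - w * cnj w"
    by (simp add: d_def algebra_simps)
  finally show ?thesis
    using e by simp
qed

lemma disk_aut_rotate:
  assumes "cmod s = 1"
  shows "disk_aut (s * w) (s * z) = s * disk_aut w z"
proof -
  have "s * cnj s = 1"
    using assms by (simp add: complex_norm_square[symmetric])
  then have "s * z * cnj (s * w) = z * cnj w"
    by (metis complex_cnj_mult mult.assoc mult.commute mult.left_neutral)
  then have "1 + s * z * cnj (s * w) = 1 + z * cnj w"
    by simp
  moreover have "s * z + s * w = s * (z + w)"
    by (simp add: algebra_simps)
  ultimately show ?thesis
    unfolding disk_aut_def by simp
qed

text \<open>The automorphism with parameter \<open>w2\<close>, precomposed with the inverse of the
  one with parameter \<open>w1\<close>, is again an automorphism of the disk, hence a rotation after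
  some \<open>disk_aut b\<close>. This reduces the comparison of two parameters to that of 0 and
  \<open>b\<close>.\<close>

lemma disk_aut_change_parameter:
  assumes z: "cmod z < 1" and w1: "cmod w1 < 1" and w2: "cmod w2 < 1"
  defines "k \<equiv> 1 - w2 * cnj w1"
  shows "disk_aut w2 z = k / cnj k * disk_aut ((w2 - w1) / k) (disk_aut w1 z)"
proof -
  have k: "k \<noteq> 0"
    using disk_aut_denom_nonzero[of w2 "- w1"] w1 w2 by (simp add: k_def)
  then have k': "cnj k \<noteq> 0"
    by simp
  define u where "u = disk_aut w1 z"
  have u: "cmod u < 1"
    unfolding u_def by (rule norm_disk_aut_less_1[OF z w1])
  have zu: "z = disk_aut (- w1) u"
    unfolding u_def by (rule disk_aut_minus_cancel[OF z w1, symmetric])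
  define d where "d = 1 - u * cnj w1"
  have d: "d \<noteq> 0"
    using disk_aut_denom_nonzero[of u "- w1"] u w1 by (auto simp: d_def)
  have "disk_aut w2 z = ((u - w1) / d + w2) / (1 + (u - w1) / d * cnj w2)"
    unfolding zu by (simp add: disk_aut_def d_def)
  also have "\<dots> = ((u - w1 + w2 * d) / d) / ((d + (u - w1) * cnj w2) / d)"
    using d by (simp add: field_simps)
  also have "\<dots> = (u - w1 + w2 * d) / (d + (u - w1) * cnj w2)"
    using d by simp
  \<comment> \<open>The numerator is \<open>k * u + (w2 - w1)\<close> and the denominator is
    \<open>cnj k + u * cnj (w2 - w1)\<close>. Factoring out \<open>k\<close> and
    \<open>cnj k\<close> leaves the unimodular factor \<open>k / cnj k\<close>.\<close>
  also have "u - w1 + w2 * d = k * (u + (w2 - w1) / k)"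
    using k k' by (simp add: field_simps) (simp add: d_def k_def algebra_simps)
  also have "d + (u - w1) * cnj w2 = cnj k * (1 + u * cnj ((w2 - w1) / k))"
    using k k' by (simp add: field_simps) (simp add: d_def k_def algebra_simps)
  also have "k * (u + (w2 - w1) / k) / \<dots> = k / cnj k * disk_aut ((w2 - w1) / k) u"
    by (simp add: disk_aut_def)
  finally show ?thesis
    by (simp add: u_def)
qed

section \<open>Strict growth of a component of \<open>nu\<close> under a hyperbolic
  translation\<close>

lemma Re_nu:
  assumes "g 0 = 0"
  shows "Re (nu g z) = g (cmod z) * (Re z / cmod z)"
  using assms by (simp add: nu_eq_sgn sgn_div_norm scaleR_conv_of_real field_simps)

text \<open>Multiplied by the positive number \<open>N\<close>, the coordinates and the squared
  modulus of the image become polynomials, from which signs and comparisons can be read off.\<close>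

lemma disk_aut_real:
  assumes "cmod z < 1" "0 < a" "a < 1"
  defines "N \<equiv> (cmod (1 + z * of_real a))\<^sup>2"
  shows "0 < N"
    and "Re (disk_aut (of_real a) z) * N = Re z * (1 + a\<^sup>2) + a * (1 + (cmod z)\<^sup>2)"
    and "Im (disk_aut (of_real a) z) * N = Im z * (1 - a\<^sup>2)"
    and "(cmod (disk_aut (of_real a) z))\<^sup>2 * N = (cmod z)\<^sup>2 + 2 * a * Re z + a\<^sup>2"
proof -
  have d: "1 + z * of_real a \<noteq> 0"
    using disk_aut_denom_nonzero[of z "of_real a"] assms by simp
  then show N: "0 < N"
    by (simp add: N_def)
  have "disk_aut (of_real a) z * of_real N = (z + of_real a) * cnj (1 + z * of_real a)"
    using d unfolding N_def complex_norm_square disk_aut_def by (simp add: field_simps)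
  also have "\<dots> = (z + of_real a) * (1 + cnj z * of_real a)"
    by simp
  finally have eq: "disk_aut (of_real a) z * of_real N = (z + of_real a) * (1 + cnj z * of_real a)" .
  show "Re (disk_aut (of_real a) z) * N = Re z * (1 + a\<^sup>2) + a * (1 + (cmod z)\<^sup>2)"
    using arg_cong[OF eq, of Re] unfolding cmod_power2
    by (simp add: power2_eq_square algebra_simps)
  show "Im (disk_aut (of_real a) z) * N = Im z * (1 - a\<^sup>2)"
    using arg_cong[OF eq, of Im] by (simp add: power2_eq_square algebra_simps)
  have "(cmod (disk_aut (of_real a) z))\<^sup>2 * N = (cmod (z + of_real a))\<^sup>2"
    using d by (simp add: disk_aut_def norm_divide power_divide N_def)
  also have "\<dots> = (cmod z)\<^sup>2 + 2 * a * Re z + a\<^sup>2"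
    unfolding cmod_power2 by (simp add: power2_eq_square algebra_simps)
  finally show "(cmod (disk_aut (of_real a) z))\<^sup>2 * N = (cmod z)\<^sup>2 + 2 * a * Re z + a\<^sup>2" .
qed

text \<open>In the right half of the disk, moving along the orbit of the translations towards 1
  increases both the radius and the cosine of the argument. The left half is reduced to this
  case by the symmetry \<open>z \<mapsto> - z\<close>, which reverses the orbits.\<close>

lemma Re_nu_disk_aut_less_right:
  assumes g0: "g 0 = 0" and mono: "mono_on {0..1} g" and pos: "\<And>r. 0 < r \<Longrightarrow> r < 1 \<Longrightarrow> 0 < g r"
    and a: "0 < a" "a < 1" and z: "cmod z < 1" "0 \<le> Re z"
    and strict: "strict_mono_on {0..1} g \<or> Im z \<noteq> 0"
  shows "Re (nu g z) < Re (nu g (disk_aut (of_real a) z))"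
proof -
  define z' where "z' = disk_aut (of_real a) z"
  define N where "N = (cmod (1 + z * of_real a))\<^sup>2"
  note D = disk_aut_real[OF z(1) a, folded N_def z'_def]
  have a2: "0 < 1 - a\<^sup>2"
    using a by (simp add: power_less_one_iff)
  have r2: "(cmod z)\<^sup>2 < 1"
    using z(1) by (simp add: power_less_one_iff)
  have z'1: "cmod z' < 1"
    unfolding z'_def using z a by (intro norm_disk_aut_less_1) auto
  have "0 < Re z' * N"
    unfolding D(2) using z a by (intro add_nonneg_pos mult_nonneg_nonneg) (auto intro!: mult_pos_pos add_pos_nonneg)
  then have x': "0 < Re z'"
    using D(1) by (simp add: zero_less_mult_iff)
  have N: "N = 1 + 2 * a * Re z + a\<^sup>2 * (cmod z)\<^sup>2"
    unfolding N_def cmod_power2 by (simp add: power2_eq_square algebra_simps)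
  \<comment> \<open>Growth of the radius: after multiplication by \<open>N\<close> the difference of
    squares splits off the positive factor \<open>1 - (cmod z)\<^sup>2\<close>, and the cofactor is
    positive because \<open>Re z\<close> is nonnegative.\<close>
  have "((cmod z')\<^sup>2 - (cmod z)\<^sup>2) * N
      = (cmod z)\<^sup>2 + 2 * a * Re z + a\<^sup>2 - (cmod z)\<^sup>2 * N"
    by (simp only: left_diff_distrib D(4))
  also have "\<dots> = (1 - (cmod z)\<^sup>2) * (2 * a * Re z + a\<^sup>2 * (1 + (cmod z)\<^sup>2))"
    unfolding N by (simp add: power2_eq_square algebra_simps)
  finally have diff: "((cmod z')\<^sup>2 - (cmod z)\<^sup>2) * N
      = (1 - (cmod z)\<^sup>2) * (2 * a * Re z + a\<^sup>2 * (1 + (cmod z)\<^sup>2))" .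
  have "0 < 2 * a * Re z + a\<^sup>2 * (1 + (cmod z)\<^sup>2)"
    using z a by (intro add_nonneg_pos) (auto intro!: mult_pos_pos add_pos_nonneg)
  then have "0 < ((cmod z')\<^sup>2 - (cmod z)\<^sup>2) * N"
    unfolding diff using r2 by simp
  then have "(cmod z)\<^sup>2 < (cmod z')\<^sup>2"
    using D(1) by (simp add: zero_less_mult_iff)
  then have r': "cmod z < cmod z'"
    by (rule power2_less_imp_less) simp
  then have r'0: "0 < cmod z'"
    using norm_ge_zero[of z] by linarith
  have gp: "0 < g (cmod z')"
    using pos r'0 z'1 by blast

  \<comment> \<open>Growth of the cosine starts with the cotangents, compared in the
    cross-multiplied form \<open>key2\<close>. As the imaginary part scales by
    \<open>(1 - a\<^sup>2) / N\<close>, this comes down to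
    \<open>Re z * (1 - a\<^sup>2) < Re z' * N\<close>.\<close>
  have "Re z * (1 - a\<^sup>2) \<le> Re z * (1 + a\<^sup>2)"
    using z by (intro mult_left_mono) auto
  moreover have "0 < a * (1 + (cmod z)\<^sup>2)"
    using a by (intro mult_pos_pos add_pos_nonneg) auto
  ultimately have "Re z * (1 - a\<^sup>2) < Re z' * N"
    unfolding D(2) by linarith
  then have key: "(Re z * \<bar>Im z\<bar> * (1 - a\<^sup>2) \<le> Re z' * \<bar>Im z\<bar> * N) \<and>
                  (Im z \<noteq> 0 \<longrightarrow> Re z * \<bar>Im z\<bar> * (1 - a\<^sup>2) < Re z' * \<bar>Im z\<bar> * N)"
    by (auto simp: mult.assoc mult.left_commute[of _ "\<bar>Im z\<bar>"] mult_left_mono)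
  have Im': "\<bar>Im z\<bar> * (1 - a\<^sup>2) = \<bar>Im z'\<bar> * N"
    using arg_cong[OF D(3), of abs] a2 D(1) by (simp add: abs_mult)
  have key2: "Re z * \<bar>Im z'\<bar> \<le> Re z' * \<bar>Im z\<bar>"
             "Im z \<noteq> 0 \<Longrightarrow> Re z * \<bar>Im z'\<bar> < Re z' * \<bar>Im z\<bar>"
    using key D(1) unfolding mult.assoc Im' by (auto simp flip: mult.assoc)
  \<comment> \<open>Adding the common term \<open>(Re z * Re z')\<^sup>2\<close> to the squared
    cotangent inequality turns it into the inequality between cosines.\<close>
  have sq: "(Re z * cmod z')\<^sup>2 = (Re z * Re z')\<^sup>2 + (Re z * \<bar>Im z'\<bar>)\<^sup>2"
           "(Re z' * cmod z)\<^sup>2 = (Re z * Re z')\<^sup>2 + (Re z' * \<bar>Im z\<bar>)\<^sup>2"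
    by (simp_all add: power_mult_distrib cmod_power2 algebra_simps)
  have "(Re z * \<bar>Im z'\<bar>)\<^sup>2 \<le> (Re z' * \<bar>Im z\<bar>)\<^sup>2"
    using key2(1) z by (intro power_mono) auto
  then have "(Re z * cmod z')\<^sup>2 \<le> (Re z' * cmod z)\<^sup>2"
    using sq by linarith
  then have le: "Re z * cmod z' \<le> Re z' * cmod z"
    by (rule power2_le_imp_le) (use x' in auto)
  have lt: "Re z * cmod z' < Re z' * cmod z" if "Im z \<noteq> 0"
  proof -
    have "(Re z * \<bar>Im z'\<bar>)\<^sup>2 < (Re z' * \<bar>Im z\<bar>)\<^sup>2"
      using key2(2)[OF that] z by (intro power_strict_mono) auto
    then have "(Re z * cmod z')\<^sup>2 < (Re z' * cmod z)\<^sup>2"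
      using sq by linarith
    then show ?thesis
      by (rule power2_less_imp_less) (use x' in auto)
  qed
  have c': "0 < Re z' / cmod z'"
    using x' r'0 by simp
  have c0: "0 \<le> Re z / cmod z"
    using z by simp
  have c: "Re z / cmod z \<le> Re z' / cmod z'"
  proof (cases "z = 0")
    \<comment> \<open>Here \<open>Re z / cmod z\<close> is 0 / 0, which is 0 and lies below the
      positive cosine of \<open>z'\<close>.\<close>
    case True
    then show ?thesis using c' by simp
  next
    case False
    then show ?thesis using le r'0 by (simp add: field_simps)
  qed
  have gle: "g (cmod z) \<le> g (cmod z')"
    using mono z(1) z'1 r' by (auto intro: mono_onD)
  have gz: "0 \<le> g (cmod z)"
    using pos[of "cmod z"] g0 z by (cases "z = 0") (auto intro: less_imp_le)
  \<comment> \<open>Both factors weakly increase. The radial one does so strictly if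
    \<open>g\<close> is strictly increasing, the cosine if \<open>z\<close> is off the real axis; in
    each case the other factor kept in the strict comparison is positive.\<close>
  have "g (cmod z) * (Re z / cmod z) < g (cmod z') * (Re z' / cmod z')"
    using strict
  proof
    assume "strict_mono_on {0..1} g"
    then have "g (cmod z) < g (cmod z')"
      using z(1) z'1 r' by (auto intro: strict_mono_onD)
    then have "g (cmod z) * (Re z' / cmod z') < g (cmod z') * (Re z' / cmod z')"
      using c' by (rule mult_strict_right_mono)
    moreover have "g (cmod z) * (Re z / cmod z) \<le> g (cmod z) * (Re z' / cmod z')"
      using c gz by (rule mult_left_mono)
    ultimately show ?thesis by linarith
  next
    assume "Im z \<noteq> 0"
    then have "z \<noteq> 0"
      by auto
    then have "Re z / cmod z < Re z' / cmod z'"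
      using lt[OF \<open>Im z \<noteq> 0\<close>] r'0 by (simp add: frac_less_eq divide_less_eq less_divide_eq mult.commute)
    then have "g (cmod z') * (Re z / cmod z) < g (cmod z') * (Re z' / cmod z')"
      using gp by (rule mult_strict_left_mono)
    moreover have "g (cmod z) * (Re z / cmod z) \<le> g (cmod z') * (Re z / cmod z)"
      using gle c0 by (rule mult_right_mono)
    ultimately show ?thesis by linarith
  qed
  then show ?thesis
    by (simp add: Re_nu g0 z'_def)
qed

lemma Re_nu_disk_aut_less:
  assumes g0: "g 0 = 0" and mono: "mono_on {0..1} g" and pos: "\<And>r. 0 < r \<Longrightarrow> r < 1 \<Longrightarrow> 0 < g r"
    and a: "0 < a" "a < 1" and z: "cmod z < 1"
    and strict: "strict_mono_on {0..1} g \<or> Im z \<noteq> 0"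
  shows "Re (nu g z) < Re (nu g (disk_aut (of_real a) z))"
proof -
  define z' where "z' = disk_aut (of_real a) z"
  have z'1: "cmod z' < 1"
    unfolding z'_def using z a by (intro norm_disk_aut_less_1) auto
  consider "0 \<le> Re z" | "Re z' \<le> 0" | "Re z < 0" "0 < Re z'"
    by linarith
  then show ?thesis
  proof cases
    case 1
    then show ?thesis
      using Re_nu_disk_aut_less_right assms by blast
  next
    case 2
    \<comment> \<open>Conjugating by the rotation through a half turn inverts the translation, so it
      carries \<open>- z'\<close>, a point of the right half, to \<open>- z\<close>. Since
      \<open>nu\<close> is odd, the inequality there gives the desired one.\<close>
    have "disk_aut (of_real a) (- z') = - disk_aut (- of_real a) z'"
      using disk_aut_rotate[of "-1" "- of_real a" z'] by simp
    also have "\<dots> = - z"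
      unfolding z'_def using disk_aut_minus_cancel[of z "of_real a"] z a by simp
    finally have reverse: "disk_aut (of_real a) (- z') = - z" .
    have a2: "a\<^sup>2 < 1"
      using a by (simp add: power_less_one_iff)
    have "Im z \<noteq> 0 \<longrightarrow> Im (- z') \<noteq> 0"
      using disk_aut_real(3)[OF z a] a2 by (auto simp: z'_def)
    then have "Re (nu g (- z')) < Re (nu g (disk_aut (of_real a) (- z')))"
      using 2 z'1 strict by (intro Re_nu_disk_aut_less_right[OF g0 mono pos a]) auto
    then have "Re (nu g (- z')) < Re (nu g (- z))"
      by (simp only: reverse)
    then show ?thesis
      using nu_mult_unit[of g "-1", OF g0] by (simp add: z'_def)
  next
    \<comment> \<open>The step crosses the imaginary axis, so positivity of \<open>g\<close> gives
      the two real parts opposite signs.\<close>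
    case 3
    have "z \<noteq> 0" "z' \<noteq> 0"
      using 3 by auto
    then have "Re (nu g z) < 0" "0 < Re (nu g z')"
      unfolding Re_nu[of g, OF g0] using 3 pos[of "cmod z"] pos[of "cmod z'"] z z'1
      by (auto simp: mult_less_0_iff zero_less_mult_iff divide_less_0_iff)
    then show ?thesis
      by (simp add: z'_def)
  qed
qed

text \<open>Rotating by \<open>cnj (sgn b)\<close> makes the parameter the positive real number
  \<open>cmod b\<close>. Both \<open>nu\<close> and the family of automorphisms are compatible with
  rotations, so the real case transfers to the component in the direction of
  \<open>b\<close>.\<close>

lemma Re_rotated_nu_disk_aut_less:
  assumes g0: "g 0 = 0" and mono: "mono_on {0..1} g" and pos: "\<And>r. 0 < r \<Longrightarrow> r < 1 \<Longrightarrow> 0 < g r"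
    and b: "b \<noteq> 0" "cmod b < 1" and z: "cmod z < 1"
    and strict: "strict_mono_on {0..1} g \<or> Im (cnj (sgn b) * z) \<noteq> 0"
  shows "Re (cnj (sgn b) * nu g z) < Re (cnj (sgn b) * nu g (disk_aut b z))"
proof -
  let ?s = "cnj (sgn b)"
  have s: "cmod ?s = 1"
    using b by (simp add: norm_sgn)
  have sb: "?s * b = of_real (cmod b)"
    using b by (simp add: sgn_div_norm scaleR_conv_of_real complex_norm_square[symmetric]
        power2_eq_square mult.commute field_simps flip: of_real_mult)
  have "Re (nu g (?s * z)) < Re (nu g (disk_aut (of_real (cmod b)) (?s * z)))"
    using b z s strict by (intro Re_nu_disk_aut_less[OF g0 mono pos]) (auto simp: norm_mult)
  also have "disk_aut (of_real (cmod b)) (?s * z) = ?s * disk_aut b z"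
    using disk_aut_rotate[OF s, of b z] sb by simp
  finally show ?thesis
    by (simp only: nu_mult_unit[of g, OF g0 s])
qed

section \<open>The integral as a continuous function of the parameter\<close>

lemma nu_bounded:
  assumes "continuous_on {0..1} g" "g 0 = 0"
  obtains B where "\<And>z. cmod z \<le> 1 \<Longrightarrow> cmod (nu g z) \<le> B"
proof -
  have "bounded (nu g ` cball 0 1)"
    using continuous_on_nu[OF assms] by (intro compact_imp_bounded compact_continuous_image) auto
  then show ?thesis
    using that unfolding bounded_iff by (metis imageI mem_cball_0)
qed

text \<open>For \<open>cmod w = 1\<close> the denominator vanishes at the boundary point
  \<open>- w\<close>, so continuity is taken on the open disk only, and \<open>\<phi>\<close> is
  regarded as a map into that restricted space.\<close>

lemma measurable_nu_disk_aut:
  assumes g: "continuous_on {0..1} g" "g 0 = 0"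
    and \<phi>: "\<phi> \<in> borel_measurable M" "\<And>x. x \<in> space M \<Longrightarrow> cmod (\<phi> x) < 1"
    and w: "cmod w \<le> 1"
  shows "(\<lambda>x. nu g (disk_aut w (\<phi> x))) \<in> borel_measurable M"
proof -
  have "continuous_on (ball 0 1) (disk_aut w)"
    unfolding disk_aut_def
    using disk_aut_denom_nonzero w by (auto intro!: continuous_intros)
  then have "continuous_on (ball 0 1) (\<lambda>z. nu g (disk_aut w z))"
    by (rule continuous_on_compose2[OF continuous_on_nu[OF g]]) (auto simp: norm_disk_aut_le_1 w)
  then have "(\<lambda>z. nu g (disk_aut w z)) \<in> borel_measurable (restrict_space borel (ball 0 1))"
    by (rule borel_measurable_continuous_on_restrict)
  moreover have "\<phi> \<in> measurable M (restrict_space borel (ball 0 1))"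
    using \<phi> by (intro measurable_restrict_space2) auto
  ultimately show ?thesis
    using measurable_compose by blast
qed

lemma integrable_nu_disk_aut:
  fixes f :: "'a \<Rightarrow> real"
  assumes g: "continuous_on {0..1} g" "g 0 = 0"
    and \<phi>: "\<phi> \<in> borel_measurable M" "\<And>x. x \<in> space M \<Longrightarrow> cmod (\<phi> x) < 1"
    and f: "integrable M f"
    and w: "cmod w \<le> 1"
  shows "integrable M (\<lambda>x. nu g (disk_aut w (\<phi> x)) * of_real (f x))"
proof -
  obtain B where B: "\<And>z. cmod z \<le> 1 \<Longrightarrow> cmod (nu g z) \<le> B"
    using nu_bounded[OF g] by blast
  show ?thesis
  proof (rule Bochner_Integration.integrable_bound)
    show "integrable M (\<lambda>x. B * f x)"
      using f by simp
    show "(\<lambda>x. nu g (disk_aut w (\<phi> x)) * of_real (f x)) \<in> borel_measurable M"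
      using measurable_nu_disk_aut[OF g \<phi> w] f by measurable
    show "AE x in M. cmod (nu g (disk_aut w (\<phi> x)) * of_real (f x)) \<le> norm (B * f x)"
    proof (rule AE_I2)
      fix x assume "x \<in> space M"
      then have "cmod (nu g (disk_aut w (\<phi> x))) \<le> \<bar>B\<bar>"
        using B norm_disk_aut_le_1[OF \<phi>(2) w] by (meson abs_ge_self order_trans)
      then show "cmod (nu g (disk_aut w (\<phi> x)) * of_real (f x)) \<le> norm (B * f x)"
        by (simp add: norm_mult abs_mult mult_right_mono)
    qed
  qed
qed

text \<open>Dominated convergence with majorant \<open>B * \<bar>f x\<bar>\<close>. Pointwise
  convergence persists for limits \<open>w\<close> on the unit circle, because
  \<open>\<phi> x\<close> lies in the open disk and the denominator stays nonzero.\<close>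

lemma continuous_on_integral_nu_disk_aut:
  fixes f :: "'a \<Rightarrow> real"
  assumes g: "continuous_on {0..1} g" "g 0 = 0"
    and \<phi>: "\<phi> \<in> borel_measurable M" "\<And>x. x \<in> space M \<Longrightarrow> cmod (\<phi> x) < 1"
    and f: "integrable M f"
  shows "continuous_on (cball 0 1) (\<lambda>w. LINT x|M. nu g (disk_aut w (\<phi> x)) * of_real (f x))"
proof -
  obtain B where B: "\<And>z. cmod z \<le> 1 \<Longrightarrow> cmod (nu g z) \<le> B"
    using nu_bounded[OF g] by blast
  show ?thesis
    unfolding continuous_on_sequentially
  proof (intro allI ballI impI)
    fix X :: "nat \<Rightarrow> complex" and w
    assume w: "w \<in> cball 0 1" and X: "(\<forall>n. X n \<in> cball 0 1) \<and> X \<longlonglongrightarrow> w"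
    show "((\<lambda>w. LINT x|M. nu g (disk_aut w (\<phi> x)) * of_real (f x)) \<circ> X)
        \<longlonglongrightarrow> (LINT x|M. nu g (disk_aut w (\<phi> x)) * of_real (f x))"
      unfolding comp_def
    proof (rule integral_dominated_convergence[where w = "\<lambda>x. B * \<bar>f x\<bar>"])
      show "(\<lambda>x. nu g (disk_aut w (\<phi> x)) * of_real (f x)) \<in> borel_measurable M"
        using integrable_nu_disk_aut[OF g \<phi> f] w by auto
      show "(\<lambda>x. nu g (disk_aut (X n) (\<phi> x)) * of_real (f x)) \<in> borel_measurable M" for n
        using integrable_nu_disk_aut[OF g \<phi> f] X by auto
      show "integrable M (\<lambda>x. B * \<bar>f x\<bar>)"
        using f by auto
      show "AE x in M. cmod (nu g (disk_aut (X n) (\<phi> x)) * of_real (f x)) \<le> B * \<bar>f x\<bar>" for n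
        using X \<phi>(2) B norm_disk_aut_le_1
        by (intro AE_I2) (auto simp: norm_mult intro!: mult_right_mono)
      show "AE x in M. (\<lambda>n. nu g (disk_aut (X n) (\<phi> x)) * of_real (f x))
          \<longlonglongrightarrow> nu g (disk_aut w (\<phi> x)) * of_real (f x)"
      proof (rule AE_I2)
        fix x assume "x \<in> space M"
        then have x: "cmod (\<phi> x) < 1"
          by (rule \<phi>)
        have "(\<lambda>n. disk_aut (X n) (\<phi> x)) \<longlonglongrightarrow> disk_aut w (\<phi> x)"
          unfolding disk_aut_def using X w disk_aut_denom_nonzero[OF x]
          by (intro tendsto_intros) auto
        then have "(\<lambda>n. nu g (disk_aut (X n) (\<phi> x))) \<longlonglongrightarrow> nu g (disk_aut w (\<phi> x))"
          by (rule continuous_on_tendsto_compose[OF continuous_on_nu[OF g]])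
             (use X w norm_disk_aut_le_1[OF x] in auto)
        then show "(\<lambda>n. nu g (disk_aut (X n) (\<phi> x)) * of_real (f x))
            \<longlonglongrightarrow> nu g (disk_aut w (\<phi> x)) * of_real (f x)"
          by (intro tendsto_intros)
      qed
    qed
  qed
qed

section \<open>Existence of a zero by Brouwer's theorem\<close>

lemma zero_in_disk_of_radial_on_circle:
  fixes V :: "complex \<Rightarrow> complex"
  assumes V: "continuous_on (cball 0 1) V" and c: "0 < c"
    and bd: "\<And>w. cmod w = 1 \<Longrightarrow> V w = of_real c * w"
  obtains w where "cmod w < 1" "V w = 0"
proof -
  have "\<exists>w\<in>cball 0 1. V w = 0"
  proof (rule ccontr)
    assume "\<not> ?thesis"
    then have nz: "\<And>w. w \<in> cball 0 1 \<Longrightarrow> V w \<noteq> 0"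
      by blast
    have "continuous_on (cball 0 1) (\<lambda>w. - sgn (V w))"
      using nz by (intro continuous_intros V) auto
    moreover have "(\<lambda>w. - sgn (V w)) \<in> cball 0 1 \<rightarrow> cball 0 1"
      by (auto simp: norm_sgn)
    ultimately obtain w where w: "w \<in> cball 0 1" "- sgn (V w) = w"
      using brouwer[of "cball (0::complex) 1" "\<lambda>w. - sgn (V w)"] by auto
    \<comment> \<open>The normalized field has values of modulus 1, so its fixed point is on the
      circle. There \<open>V\<close> points outward, which makes \<open>w\<close> equal to its own
      negative.\<close>
    then have "cmod w = 1"
      using nz[OF w(1)] norm_minus_cancel[of "sgn (V w)"] by (simp add: norm_sgn)
    then have "sgn (V w) = w"
      using c by (simp add: bd sgn_mult sgn_of_real) (simp add: sgn_div_norm)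
    then have "2 * w = 0"
      using w(2) unfolding mult_2 by (metis add.right_inverse)
    then show False
      using \<open>cmod w = 1\<close> by auto
  qed
  then obtain w where w: "w \<in> cball 0 1" "V w = 0"
    by blast
  then have "cmod w \<noteq> 1"
    using bd[of w] c by auto
  then show ?thesis
    using w by (intro that[of w]) auto
qed

lemma exists_orthogonal_disk_aut:
  fixes f :: "'a \<Rightarrow> real"
  assumes g: "continuous_on {0..1} g" "g 0 = 0" and g1: "0 < g 1"
    and \<phi>: "\<phi> \<in> borel_measurable M" "\<And>x. x \<in> space M \<Longrightarrow> cmod (\<phi> x) < 1"
    and f: "integrable M f" and f0: "0 < (LINT x|M. f x)"
  obtains w where "cmod w < 1" "(LINT x|M. nu g (disk_aut w (\<phi> x)) * of_real (f x)) = 0"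
proof (rule zero_in_disk_of_radial_on_circle)
  show "continuous_on (cball 0 1) (\<lambda>w. LINT x|M. nu g (disk_aut w (\<phi> x)) * of_real (f x))"
    by (rule continuous_on_integral_nu_disk_aut[OF g \<phi> f])
  show "0 < g 1 * (LINT x|M. f x)"
    using g1 f0 by simp
  fix w :: complex assume w: "cmod w = 1"
  have "(LINT x|M. nu g (disk_aut w (\<phi> x)) * of_real (f x))
      = (LINT x|M. of_real (g 1) * w * of_real (f x))"
    using w by (intro Bochner_Integration.integral_cong)
      (auto simp: disk_aut_boundary[OF \<phi>(2)] nu_eq_sgn g sgn_div_norm)
  then show "(LINT x|M. nu g (disk_aut w (\<phi> x)) * of_real (f x))
      = of_real (g 1 * (LINT x|M. f x)) * w"
    by simp
qed (use that in auto)

section \<open>Uniqueness of the zero\<close>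

text \<open>Two distinct zeros would give a function that is positive almost everywhere but has
  integral 0 against \<open>f\<close>. The second strictness alternative ranges over all
  \<open>w\<close> and \<open>s\<close> because the line to be avoided depends on the two
  zeros.\<close>

lemma orthogonal_disk_aut_unique:
  fixes f :: "'a \<Rightarrow> real"
  assumes g: "continuous_on {0..1} g" "g 0 = 0"
    and mono: "mono_on {0..1} g" and pos: "\<And>r. 0 < r \<Longrightarrow> r < 1 \<Longrightarrow> 0 < g r"
    and \<phi>: "\<phi> \<in> borel_measurable M" "\<And>x. x \<in> space M \<Longrightarrow> cmod (\<phi> x) < 1"
    and f: "integrable M f" "\<And>x. x \<in> space M \<Longrightarrow> 0 \<le> f x" and f0: "0 < (LINT x|M. f x)"
    and strict: "strict_mono_on {0..1} g \<or>
      (\<forall>w s. cmod w < 1 \<longrightarrow> cmod s = 1 \<longrightarrow> (AE x in M. Im (cnj s * disk_aut w (\<phi> x)) \<noteq> 0))"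
    and w1: "cmod w1 < 1" "(LINT x|M. nu g (disk_aut w1 (\<phi> x)) * of_real (f x)) = 0"
    and w2: "cmod w2 < 1" "(LINT x|M. nu g (disk_aut w2 (\<phi> x)) * of_real (f x)) = 0"
  shows "w1 = w2"
proof (rule ccontr)
  assume neq: "w1 \<noteq> w2"
  define k where "k = 1 - w2 * cnj w1"
  \<comment> \<open>As a value of \<open>disk_aut\<close> the number \<open>b\<close> visibly lies
    in the disk; as the quotient \<open>bk\<close> it is the parameter produced by the change of
    parameter, and it is nonzero since the zeros differ.\<close>
  define b where "b = disk_aut (- w1) w2"
  have bk: "b = (w2 - w1) / k"
    by (simp add: b_def disk_aut_def k_def)
  have k: "k \<noteq> 0"
    using disk_aut_denom_nonzero[of w2 "- w1"] w1 w2 by (simp add: k_def)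
  have b: "b \<noteq> 0" "cmod b < 1"
    using neq k bk norm_disk_aut_less_1[of w2 "- w1"] w1 w2 by (simp_all add: b_def)
  define s where "s = sgn b"
  have s: "cmod s = 1"
    using b by (simp add: s_def norm_sgn)
  define e where "e = k / cnj k"
  have e: "cmod e = 1"
    using k by (simp add: e_def norm_divide)
  define u where "u x = disk_aut w1 (\<phi> x)" for x
  have u: "cmod (u x) < 1" if "x \<in> space M" for x
    unfolding u_def using norm_disk_aut_less_1 \<phi>(2)[OF that] w1 by blast
  have change: "nu g (disk_aut w2 (\<phi> x)) = e * nu g (disk_aut b (u x))" if "x \<in> space M" for x
    using disk_aut_change_parameter[OF \<phi>(2)[OF that] w1(1) w2(1)] nu_mult_unit[of g, OF g(2) e]
    by (simp add: u_def bk k_def e_def)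
  define I1 where "I1 x = nu g (u x) * of_real (f x)" for x
  define I2 where "I2 x = nu g (disk_aut b (u x)) * of_real (f x)" for x
  \<comment> \<open>The unimodular constant \<open>e\<close> can be divided out, so the second zero
    also makes the integral of \<open>I2\<close> vanish.\<close>
  have I2_eq: "I2 x = inverse e * (nu g (disk_aut w2 (\<phi> x)) * of_real (f x))" if "x \<in> space M" for x
  proof -
    have "e \<noteq> 0"
      using e by auto
    then show ?thesis
      using change[OF that] by (simp add: I2_def)
  qed
  have int1: "integrable M I1"
    using integrable_nu_disk_aut[OF g \<phi> f(1)] w1 by (simp add: I1_def[abs_def] u_def)
  have "integrable M (\<lambda>x. inverse e * (nu g (disk_aut w2 (\<phi> x)) * of_real (f x)))"
    using integrable_nu_disk_aut[OF g \<phi> f(1)] w2 by (intro integrable_mult_right) auto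
  then have int2: "integrable M I2"
    by (subst Bochner_Integration.integrable_cong[OF refl I2_eq])
  have zero1: "integral\<^sup>L M I1 = 0"
    using w1 by (simp add: I1_def[abs_def] u_def)
  have "integral\<^sup>L M I2 = (LINT x|M. inverse e * (nu g (disk_aut w2 (\<phi> x)) * of_real (f x)))"
    by (rule Bochner_Integration.integral_cong[OF refl I2_eq])
  then have zero2: "integral\<^sup>L M I2 = 0"
    using w2 by simp
  \<comment> \<open>The gain of \<open>nu\<close> in the direction \<open>s\<close> when the
    translation by \<open>b\<close> is applied to \<open>u x\<close>.\<close>
  define D where "D x = Re (cnj s * nu g (disk_aut b (u x))) - Re (cnj s * nu g (u x))" for x
  have Df: "D x * f x = Re (cnj s * I2 x - cnj s * I1 x)" for x
    by (simp add: D_def I1_def I2_def algebra_simps)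
  have intD: "integrable M (\<lambda>x. D x * f x)"
    unfolding Df using int1 int2 by (intro integrable_Re) auto
  have "(LINT x|M. D x * f x) = Re (LINT x|M. cnj s * I2 x - cnj s * I1 x)"
    unfolding Df using int1 int2 by (intro integral_Re) auto
  also have "\<dots> = 0"
    using int1 int2 zero1 zero2 by simp
  finally have zeroD: "(LINT x|M. D x * f x) = 0" .
  have Dpos: "AE x in M. 0 < D x"
    using strict
  proof
    assume "strict_mono_on {0..1} g"
    then show ?thesis
      using Re_rotated_nu_disk_aut_less[of g, OF g(2) mono pos b u]
      by (intro AE_I2) (auto simp: D_def s_def)
  next
    assume "\<forall>w s. cmod w < 1 \<longrightarrow> cmod s = 1 \<longrightarrow> (AE x in M. Im (cnj s * disk_aut w (\<phi> x)) \<noteq> 0)"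
    then have "AE x in M. Im (cnj s * u x) \<noteq> 0"
      using w1 s by (simp add: u_def)
    then show ?thesis
    proof (rule AE_mp, intro AE_I2 impI)
      fix x assume "x \<in> space M" "Im (cnj s * u x) \<noteq> 0"
      then show "0 < D x"
        using Re_rotated_nu_disk_aut_less[of g, OF g(2) mono pos b u]
        by (simp add: D_def s_def)
    qed
  qed
  have "AE x in M. 0 \<le> D x * f x"
    using Dpos by (rule AE_mp) (auto intro!: AE_I2 mult_nonneg_nonneg f(2))
  then have "AE x in M. D x * f x = 0"
    using integral_nonneg_eq_0_iff_AE[OF intD] zeroD by blast
  with Dpos have "AE x in M. f x = 0"
    by eventually_elim auto
  then have "(LINT x|M. f x) = 0"
    by (rule integral_eq_zero_AE)
  with f0 show False by simp
qed

section \<open>Null preimages of lines under a diffeomorphism\<close>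

lemma negligible_complex_line:
  assumes "s \<noteq> 0"
  shows "negligible {v. Im (cnj s * v) = 0}"
proof -
  have "Im (cnj s * v) = (\<i> * s) \<bullet> v" for v
    by (simp add: inner_complex_def algebra_simps)
  then show ?thesis
    using assms negligible_hyperplane[of "\<i> * s" 0] by simp
qed

lemma disk_aut_differentiable_on:
  assumes "cmod w < 1"
  shows "disk_aut w differentiable_on ball 0 1"
proof -
  have "disk_aut w field_differentiable (at z)" if "z \<in> ball 0 1" for z
    unfolding disk_aut_def
    using disk_aut_denom_nonzero[of z w] that assms
    by (intro derivative_intros) auto
  then show ?thesis
    by (auto intro!: differentiable_at_imp_differentiable_on field_differentiable_imp_differentiable)
qed

text \<open>Pulled back by the inverse automorphism and then by the inverse of \<open>F\<close>, the
  line is a differentiable image of a null set, and such images are null in equal dimension.\<close>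

lemma negligible_diffeomorphism_preimage_line:
  fixes F :: "complex \<Rightarrow> complex"
  assumes F: "C1_diffeomorphism F \<Omega> (ball 0 1)" and w: "cmod w < 1" and s: "s \<noteq> 0"
  shows "negligible {z \<in> \<Omega>. Im (cnj s * disk_aut w (F z)) = 0}"
proof -
  define G where "G = inv_into \<Omega> F"
  have bij: "bij_betw F \<Omega> (ball 0 1)"
    using F by (simp add: C1_diffeomorphism_def)
  have G: "G differentiable_on ball 0 1"
    using F unfolding C1_diffeomorphism_def C1_on_def G_def
    by (meson differentiable_at_imp_differentiable_on differentiableI)
  have T: "disk_aut (- w) differentiable_on ball 0 1"
    using w by (intro disk_aut_differentiable_on) simp
  define L where "L = {v \<in> ball 0 1. Im (cnj s * v) = 0}"
  have "negligible L"
    using negligible_complex_line[OF s] by (rule negligible_subset) (auto simp: L_def)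
  then have "negligible (disk_aut (- w) ` L)"
    by (intro negligible_differentiable_image_negligible differentiable_on_subset[OF T])
       (auto simp: L_def)
  then have neg: "negligible (G ` disk_aut (- w) ` L)"
  proof (rule negligible_differentiable_image_negligible[rotated])
    show "G differentiable_on disk_aut (- w) ` L"
      by (rule differentiable_on_subset[OF G]) (use w in \<open>auto simp: L_def norm_disk_aut_less_1\<close>)
  qed simp
  have "{z \<in> \<Omega>. Im (cnj s * disk_aut w (F z)) = 0} \<subseteq> G ` disk_aut (- w) ` L"
  proof
    fix z assume z: "z \<in> {z \<in> \<Omega>. Im (cnj s * disk_aut w (F z)) = 0}"
    then have Fz: "cmod (F z) < 1"
      using bij_betwE[OF bij] by auto
    have "disk_aut w (F z) \<in> L"
      using z norm_disk_aut_less_1[OF Fz w] by (simp add: L_def)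
    moreover have "z = G (disk_aut (- w) (disk_aut w (F z)))"
      using z bij by (simp add: G_def disk_aut_minus_cancel[OF Fz w] bij_betw_def inv_into_f_f)
    ultimately show "z \<in> G ` disk_aut (- w) ` L"
      by blast
  qed
  then show ?thesis
    by (rule negligible_subset[OF neg])
qed

theorem corollary7:
  fixes g :: "real \<Rightarrow> real"
    and \<Omega> :: "complex set"
    and f :: "complex \<Rightarrow> real"
    and F :: "complex \<Rightarrow> complex"
  assumes "continuous_on {0..1} g" and "g 0 = 0"
    and "open \<Omega>" and "connected \<Omega>" and "simply_connected \<Omega>"
    and "\<And>z. z \<in> \<Omega> \<Longrightarrow> 0 \<le> f z"
    and "set_integrable lebesgue \<Omega> f"
    and "0 < (LINT z:\<Omega>|lebesgue. f z)"
    and "continuous_on \<Omega> F" and "F \<in> \<Omega> \<rightarrow> ball 0 1"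
    and "0 < g 1"
  shows "(\<exists>w\<in>ball 0 1. (LINT z:\<Omega>|lebesgue. nu g (disk_aut w (F z)) * of_real (f z)) = 0) \<and>
    (strict_mono_on {0..1} g \<or>
       (C1_diffeomorphism F \<Omega> (ball 0 1) \<and> mono_on {0..1} g \<and> (\<forall>r. 0 < r \<and> r < 1 \<longrightarrow> 0 < g r))
     \<longrightarrow> (\<exists>!w. w \<in> ball 0 1 \<and>
            (LINT z:\<Omega>|lebesgue. nu g (disk_aut w (F z)) * of_real (f z)) = 0))"
proof -
  let ?M = "lebesgue_on \<Omega>"
  have \<Omega>: "\<Omega> \<in> sets lebesgue"
    using \<open>open \<Omega>\<close> by auto
  \<comment> \<open>Set integrals over \<open>\<Omega>\<close> become integrals for the measure
    \<open>lebesgue_on \<Omega>\<close>, to which the lemmas on a general measure space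
    apply.\<close>
  have LINT_eq: "(LINT z:\<Omega>|lebesgue. h z) = integral\<^sup>L ?M h"
    for h :: "complex \<Rightarrow> 'b::{banach, second_countable_topology}"
    using \<Omega> by (simp add: set_lebesgue_integral_def integral_restrict_space)
  have F: "F \<in> borel_measurable ?M"
    by (rule continuous_imp_measurable_on_sets_lebesgue[OF \<open>continuous_on \<Omega> F\<close> \<Omega>])
  have F1: "cmod (F z) < 1" if "z \<in> space ?M" for z
    using that \<open>F \<in> \<Omega> \<rightarrow> ball 0 1\<close> by auto
  have f: "integrable ?M f"
    using \<open>set_integrable lebesgue \<Omega> f\<close> \<Omega> by (simp add: set_integrable_def integrable_restrict_space)
  have f_nonneg: "0 \<le> f z" if "z \<in> space ?M" for z
    using that assms(6) by auto
  have f0: "0 < integral\<^sup>L ?M f"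
    using assms(8) by (simp add: LINT_eq)
  define P where "P w \<longleftrightarrow> (LINT z|?M. nu g (disk_aut w (F z)) * of_real (f z)) = 0" for w
  obtain w where w: "cmod w < 1" "P w"
    using exists_orthogonal_disk_aut[OF assms(1,2,11) F F1 f f0] unfolding P_def by blast
  have unique: "w1 = w2"
    if hyp: "strict_mono_on {0..1} g \<or>
       (C1_diffeomorphism F \<Omega> (ball 0 1) \<and> mono_on {0..1} g \<and> (\<forall>r. 0 < r \<and> r < 1 \<longrightarrow> 0 < g r))"
      and w12: "cmod w1 < 1" "P w1" "cmod w2 < 1" "P w2" for w1 w2
  proof -
    have mono: "mono_on {0..1} g"
      using hyp strict_mono_on_imp_mono_on by blast
    \<comment> \<open>Under the first alternative positivity comes from strict growth starting at
      \<open>g 0 = 0\<close>.\<close>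
    have pos: "0 < g r" if "0 < r" "r < 1" for r
      using hyp that strict_mono_onD[of "{0..1}" g 0 r] \<open>g 0 = 0\<close> by auto
    have "AE z in ?M. Im (cnj s * disk_aut w (F z)) \<noteq> 0"
      if "C1_diffeomorphism F \<Omega> (ball 0 1)" "cmod w < 1" "cmod s = 1" for w s
    proof -
      have "s \<noteq> 0"
        using that by auto
      then have "negligible {z \<in> \<Omega>. Im (cnj s * disk_aut w (F z)) = 0}"
        using negligible_diffeomorphism_preimage_line that by blast
      then have "AE z in lebesgue. z \<notin> {z \<in> \<Omega>. Im (cnj s * disk_aut w (F z)) = 0}"
        unfolding negligible_iff_null_sets by (rule AE_not_in)
      then show ?thesis
        using \<Omega> by (simp add: AE_restrict_space_iff)
    qed
    then have "strict_mono_on {0..1} g \<or>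
      (\<forall>w s. cmod w < 1 \<longrightarrow> cmod s = 1 \<longrightarrow> (AE z in ?M. Im (cnj s * disk_aut w (F z)) \<noteq> 0))"
      using hyp by blast
    then show ?thesis
      using orthogonal_disk_aut_unique[OF assms(1,2) mono pos F F1 f f_nonneg f0] w12
      unfolding P_def by blast
  qed
  show ?thesis
    unfolding LINT_eq P_def[symmetric] Bex_def mem_ball_0
  proof (intro conjI impI)
    show "\<exists>w. cmod w < 1 \<and> P w"
      using w by blast
  qed (use w unique in blast)
qed
end
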